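(* Let the setting, the system (ODE), the function $G$ and the relaxation functions $\mathbf{x}_{0,P\times\Omega}^{cv},\mathbf{x}_{0,P\times\Omega}^{cc},\mathbf{f}^{cv}_{P\times\Omega},\mathbf{f}^{cc}_{P\times\Omega},g^{cv}_{P\times\Omega},g^{cc}_{P\times\Omega}$ be as described in the context. Choose any intervals $P\in\mathbb{I}\overline{P}$ and $\Omega\in\mathbb{I}\overline{\Omega}$ and define the auxiliary system of ODEs $$\dot{\mathbf{x}}^{cv}(t,\mathbf{p},\boldsymbol{\omega}) = \mathbf{f}^{cv}_{P\times\Omega}(t,\mathbf{p},\boldsymbol{\omega},\mathbf{x}^{cv}(t,\mathbf{p},\boldsymbol{\omega}),\mathbf{x}^{cc}(t,\mathbf{p},\boldsymbol{\omega})),$$ $$\dot{\mathbf{x}}^{cc}(t,\mathbf{p},\boldsymbol{\omega}) = \mathbf{f}^{cc}_{P\times\Omega}(t,\mathbf{p},\boldsymbol{\omega},\mathbf{x}^{cv}(t,\mathbf{p},\boldsymbol{\omega}),\mathbf{x}^{cc}(t,\mathbf{p},\boldsymbol{\omega})),$$ $$\mathbf{x}^{cv}(t_0,\mathbf{p},\boldsymbol{\omega}) = \mathbf{x}^{cv}_{0,P\times\Omega}(\mathbf{p},\boldsymbol{\omega}),\qquad \mathbf{x}^{cc}(t_0,\mathbf{p},\boldsymbol{\omega}) = \mathbf{x}^{cc}_{0,P\times\Omega}(\mathbf{p},\boldsymbol{\omega}),$$ for all $(t,\mathbf{p},\boldsymbol{\omega})\in I\times P\times\Omega$. This system has unique solutions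 $\mathbf{x}^{cv},\mathbf{x}^{cc}:I\times P\times\Omega\rightarrow\mathbb{R}^{n_x}$, and these solutions are state relaxations for (ODE) on $P\times\Omega$. Moreover, the functions $$G^{cv}_{P\times\Omega}(\mathbf{p},\boldsymbol{\omega}) \equiv g_{P\times\Omega}^{cv}(\mathbf{p},\boldsymbol{\omega},\mathbf{x}^{cv}(t_f,\mathbf{p},\boldsymbol{\omega}),\mathbf{x}^{cc}(t_f,\mathbf{p},\boldsymbol{\omega})),$$ $$G^{cc}_{P\times\Omega}(\mathbf{p},\boldsymbol{\omega}) \equiv g_{P\times\Omega}^{cc}(\mathbf{p},\boldsymbol{\omega},\mathbf{x}^{cv}(t_f,\mathbf{p},\boldsymbol{\omega}),\mathbf{x}^{cc}(t_f,\mathbf{p},\boldsymbol{\omega})),$$ are, respectively, convex and concave relaxations of $G$ on $P\times\Omega$.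
   Context: **Notation.** For $\mathbf{s}^L,\mathbf{s}^U\in\mathbb{R}^n$ with $\mathbf{s}^L\le\mathbf{s}^U$ (componentwise), $[\mathbf{s}^L,\mathbf{s}^U]=\{\mathbf{s}\in\mathbb{R}^n:\mathbf{s}^L\le\mathbf{s}\le\mathbf{s}^U\}$ is a compact $n$-dimensional interval. For $\overline{S}\subset\mathbb{R}^n$, $\mathbb{I}\overline{S}$ denotes the set of all compact interval subsets of $\overline{S}$. **Relaxations.** Let $S\subset\mathbb{R}^n$ be convex and $h:S\to\mathbb{R}$. Functions $h^{cv},h^{cc}:S\to\mathbb{R}$ are convex and concave relaxations of $h$ on $S$, respectively, if $h^{cv}$ is convex on $S$, $h^{cc}$ is concave on $S$, and $h^{cv}(\mathbf{s})\le h(\mathbf{s})\le h^{cc}(\mathbf{s})$ for all $\mathbf{s}\in S$. For vector-valued functions this is understood componentwise. **Setting.** Let $I=[t_0,t_f]\subset\mathbb{R}$, let $\overline{P}\subset\mathbb{R}^{n_p}$ and $\overline{\Omega}\subset\mathbb{R}^{n_\omega}$ be compact intervals. Let $\mathbf{x}_0:\mathbb{R}^{n_p}\times\mathbb{R}^{n_\omega}\to\mathbb{R}^{n_x}$ and $\mathbf{f}:\mathbb{R}\times\mathbb{R}^{n_p}\times\mathbb{R}^{n_\omega}\times\mathbb{R}^{n_x}\to\mathbb{R}^{n_x}$ be locally Lipschitz continuous. Consider the initial value problem (ODE) $\dot{\mathbf{x}}(t,\mathbf{p},\boldsymbol{\omega})=\mathbf{f}(t,\mathbf{p},\boldsymbol{\omega},\mathbf{x}(t,\mathbf{p},\boldsymbol{\omega}))$,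 $\ \mathbf{x}(t_0,\mathbf{p},\boldsymbol{\omega})=\mathbf{x}_0(\mathbf{p},\boldsymbol{\omega})$, where the dot is the derivative with respect to $t$. It is assumed that (ODE) has a unique solution $\mathbf{x}(\cdot,\mathbf{p},\boldsymbol{\omega})$ on all of $I$ for every $(\mathbf{p},\boldsymbol{\omega})\in\overline{P}\times\overline{\Omega}$. Let $g:\mathbb{R}^{n_p}\times\mathbb{R}^{n_\omega}\times\mathbb{R}^{n_x}\to\mathbb{R}$ and $G(\mathbf{p},\boldsymbol{\omega})\equiv g(\mathbf{p},\boldsymbol{\omega},\mathbf{x}(t_f,\mathbf{p},\boldsymbol{\omega}))$. **State relaxations.** For $P\in\mathbb{I}\overline{P}$ and $\Omega\in\mathbb{I}\overline{\Omega}$, functions $\mathbf{x}^{cv},\mathbf{x}^{cc}:I\times P\times\Omega\to\mathbb{R}^{n_x}$ are called state relaxations for (ODE) on $P\times\Omega$ if, for every $t\in I$, $\mathbf{x}^{cv}(t,\cdot,\cdot)$ and $\mathbf{x}^{cc}(t,\cdot,\cdot)$ are, respectively, convex and concave relaxations of $\mathbf{x}(t,\cdot,\cdot)$ on $P\times\Omega$. **Assumption on available relaxation functions.** For all intervals $P\in\mathbb{I}\overline{P}$, $\Omega\in\mathbb{I}\overline{\Omega}$, the following functions are given: 1. $\mathbf{x}_{0,P\times\Omega}^{cv},\mathbf{x}_{0,P\times\Omega}^{cc}:P\times\Omega\to\mathbb{R}^{n_x}$ are continuous convex and concave relaxations of $\mathbf{x}_0$ on $P\times\Omega$. 2. $\mathbf{f}^{cv}_{P\times\Omega},\mathbf{f}^{cc}_{P\times\Omega}:I\times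 P\times\Omega\times\mathbb{R}^{n_x}\times\mathbb{R}^{n_x}\to\mathbb{R}^{n_x}$ are Lipschitz continuous and satisfy: for any continuous $\boldsymbol{\phi},\boldsymbol{\psi}:I\times P\times\Omega\to\mathbb{R}^{n_x}$ and any fixed $t\in I$, the functions $(\mathbf{p},\boldsymbol{\omega})\mapsto\mathbf{f}^{cv}_{P\times\Omega}(t,\mathbf{p},\boldsymbol{\omega},\boldsymbol{\phi}(t,\mathbf{p},\boldsymbol{\omega}),\boldsymbol{\psi}(t,\mathbf{p},\boldsymbol{\omega}))$ and $(\mathbf{p},\boldsymbol{\omega})\mapsto\mathbf{f}^{cc}_{P\times\Omega}(t,\mathbf{p},\boldsymbol{\omega},\boldsymbol{\phi}(t,\mathbf{p},\boldsymbol{\omega}),\boldsymbol{\psi}(t,\mathbf{p},\boldsymbol{\omega}))$ are respectively convex and concave relaxations of $(\mathbf{p},\boldsymbol{\omega})\mapsto\mathbf{f}(t,\mathbf{p},\boldsymbol{\omega},\mathbf{x}(t,\mathbf{p},\boldsymbol{\omega}))$ on $P\times\Omega$, provided that $\boldsymbol{\phi}(t,\cdot,\cdot)$ and $\boldsymbol{\psi}(t,\cdot,\cdot)$ are respectively convex and concave relaxations of $\mathbf{x}(t,\cdot,\cdot)$ on $P\times\Omega$. 3. $g^{cv}_{P\times\Omega},g^{cc}_{P\times\Omega}:P\times\Omega\times\mathbb{R}^{n_x}\times\mathbb{R}^{n_x}\to\mathbb{R}$ are Lipschitz continuous and satisfy: for any continuous $\boldsymbol{\phi},\boldsymbol{\psi}:P\times\Omega\to\mathbb{R}^{n_x}$,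 the functions $(\mathbf{p},\boldsymbol{\omega})\mapsto g^{cv}_{P\times\Omega}(\mathbf{p},\boldsymbol{\omega},\boldsymbol{\phi}(\mathbf{p},\boldsymbol{\omega}),\boldsymbol{\psi}(\mathbf{p},\boldsymbol{\omega}))$ and $(\mathbf{p},\boldsymbol{\omega})\mapsto g^{cc}_{P\times\Omega}(\mathbf{p},\boldsymbol{\omega},\boldsymbol{\phi}(\mathbf{p},\boldsymbol{\omega}),\boldsymbol{\psi}(\mathbf{p},\boldsymbol{\omega}))$ are respectively convex and concave relaxations of $(\mathbf{p},\boldsymbol{\omega})\mapsto g(\mathbf{p},\boldsymbol{\omega},\mathbf{x}(t_f,\mathbf{p},\boldsymbol{\omega}))$ on $P\times\Omega$, provided that $\boldsymbol{\phi}$ and $\boldsymbol{\psi}$ are respectively convex and concave relaxations of $\mathbf{x}(t_f,\cdot,\cdot)$ on $P\times\Omega$. *)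

theory Defs
  imports "HOL-Analysis.Analysis"
begin

definition interval_subsets :: "'a::ordered_euclidean_space set \<Rightarrow> 'a set set" where
  "interval_subsets S = {{a..b} |a b. a \<le> b \<and> {a..b} \<subseteq> S}"

(* The library's local_lipschitz is about a function of a parameter and a state and asks for a
   Lipschitz bound in the state only; here the bound is in all arguments jointly. *)
definition locally_lipschitz_on ::
    "'a::metric_space set \<Rightarrow> ('a \<Rightarrow> 'b::metric_space) \<Rightarrow> bool" where
  "locally_lipschitz_on S h \<longleftrightarrow>
     (\<forall>s\<in>S. \<exists>u>0. \<exists>L. L-lipschitz_on (cball s u \<inter> S) h)"

definition lipschitz_continuous_on ::
    "'a::metric_space set \<Rightarrow> ('a \<Rightarrow> 'b::metric_space) \<Rightarrow> bool" where
  "lipschitz_continuous_on S h \<longleftrightarrow> (\<exists>L. L-lipschitz_on S h)"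

definition relaxations_on ::
    "'a::real_vector set \<Rightarrow> ('a \<Rightarrow> real) \<Rightarrow> ('a \<Rightarrow> real) \<Rightarrow> ('a \<Rightarrow> real) \<Rightarrow> bool" where
  "relaxations_on S h hcv hcc \<longleftrightarrow>
     convex_on S hcv \<and> concave_on S hcc \<and> (\<forall>s\<in>S. hcv s \<le> h s \<and> h s \<le> hcc s)"

definition vec_relaxations_on ::
    "'a::real_vector set \<Rightarrow> ('a \<Rightarrow> real^'n) \<Rightarrow> ('a \<Rightarrow> real^'n) \<Rightarrow> ('a \<Rightarrow> real^'n) \<Rightarrow> bool" where
  "vec_relaxations_on S h hcv hcc \<longleftrightarrow>
     (\<forall>i. relaxations_on S (\<lambda>s. h s $ i) (\<lambda>s. hcv s $ i) (\<lambda>s. hcc s $ i))"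

(* The derivative is taken within {t0..tf}, hence one-sided at the end points. *)
definition solves_ode ::
    "real \<Rightarrow> real \<Rightarrow> (real \<Rightarrow> 'p \<Rightarrow> 'w \<Rightarrow> 'x \<Rightarrow> 'x::real_normed_vector) \<Rightarrow> ('p \<Rightarrow> 'w \<Rightarrow> 'x) \<Rightarrow>
     'p \<Rightarrow> 'w \<Rightarrow> (real \<Rightarrow> 'x) \<Rightarrow> bool" where
  "solves_ode t0 tf f x0 p w y \<longleftrightarrow>
     y t0 = x0 p w \<and>
     (\<forall>t\<in>{t0..tf}. (y has_vector_derivative f t p w (y t)) (at t within {t0..tf}))"

definition solves_aux_system ::
    "real \<Rightarrow> real \<Rightarrow> 'p set \<Rightarrow> 'w set \<Rightarrow>
     (real \<Rightarrow> 'p \<Rightarrow> 'w \<Rightarrow> 'x \<Rightarrow> 'x \<Rightarrow> 'x::real_normed_vector) \<Rightarrow>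
     (real \<Rightarrow> 'p \<Rightarrow> 'w \<Rightarrow> 'x \<Rightarrow> 'x \<Rightarrow> 'x) \<Rightarrow>
     ('p \<Rightarrow> 'w \<Rightarrow> 'x) \<Rightarrow> ('p \<Rightarrow> 'w \<Rightarrow> 'x) \<Rightarrow>
     (real \<Rightarrow> 'p \<Rightarrow> 'w \<Rightarrow> 'x) \<Rightarrow> (real \<Rightarrow> 'p \<Rightarrow> 'w \<Rightarrow> 'x) \<Rightarrow> bool" where
  "solves_aux_system t0 tf P W fcv fcc x0cv x0cc xcv xcc \<longleftrightarrow>
     (\<forall>p\<in>P. \<forall>w\<in>W.
        xcv t0 p w = x0cv p w \<and> xcc t0 p w = x0cc p w \<and>
        (\<forall>t\<in>{t0..tf}.
           ((\<lambda>s. xcv s p w) has_vector_derivative fcv t p w (xcv t p w) (xcc t p w))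
             (at t within {t0..tf}) \<and>
           ((\<lambda>s. xcc s p w) has_vector_derivative fcc t p w (xcv t p w) (xcc t p w))
             (at t within {t0..tf})))"

definition state_relaxations ::
    "real \<Rightarrow> real \<Rightarrow> 'p::real_vector set \<Rightarrow> 'w::real_vector set \<Rightarrow>
     (real \<Rightarrow> 'p \<Rightarrow> 'w \<Rightarrow> real^'n) \<Rightarrow>
     (real \<Rightarrow> 'p \<Rightarrow> 'w \<Rightarrow> real^'n) \<Rightarrow> (real \<Rightarrow> 'p \<Rightarrow> 'w \<Rightarrow> real^'n) \<Rightarrow> bool" where
  "state_relaxations t0 tf P W x xcv xcc \<longleftrightarrow>
     (\<forall>t\<in>{t0..tf}. vec_relaxations_on (P \<times> W)
        (\<lambda>(p, w). x t p w) (\<lambda>(p, w). xcv t p w) (\<lambda>(p, w). xcc t p w))"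

end

(* Both the comparison of solutions and the local boundedness of the solution map rest on
   Gronwall's inequality. Since x is bounded on I \<times> P \<times> W, large constants are state relaxations,
   and Picard iteration of the auxiliary system can be started from them. By the hypotheses on the
   right-hand sides, and because integration in time and addition preserve convexity and bounds,
   every iterate is again a pair of state relaxations; so is the uniform limit of the iterates,
   which is the solution of the auxiliary system. *)
theory Submission
  imports Defs
begin

text \<open>The iteration has to start from a genuine state relaxation, because
  \<open>f_relaxations\<close> says nothing about other arguments; the initial relaxations held
  constant in time would in general fail to enclose \<open>x\<close> at later times. Hence the need
  for a bound on \<open>x\<close>. It is not immediate: \<open>f\<close> is only locally Lipschitz,
  and no continuity of \<open>x\<close> in the parameters is assumed, so compactness of the
  parameter set cannot be applied to \<open>x\<close> directly. The auxiliary right-hand sides, by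
  contrast, have one Lipschitz constant for all states, so the iterates converge on the whole time
  interval from any continuous start, however far it is from the solution. Uniformity of the
  convergence in time and parameters makes the limit jointly continuous, which yields its time
  derivative and the continuity at the final time that \<open>g_relaxations\<close> demands.\<close>

section \<open>Gronwall's inequality, parametric integrals and locally Lipschitz maps\<close>

lemma gronwall_integral:
  fixes d :: "real \<Rightarrow> real"
  assumes d: "continuous_on {a..b} d" and L: "0 \<le> L"
    and le: "\<And>t. t \<in> {a..b} \<Longrightarrow> d t \<le> c + L * integral {a..t} d"
    and t: "t \<in> {a..b}"
  shows "d t \<le> c * exp (L * (t - a))"
proof -
  define R where "R = (\<lambda>t. integral {a..t} d)"
  \<comment> \<open>The exponential is the integrating factor: the derivative of \<open>h\<close>
    has the sign of \<open>d - (c + L * R)\<close>, which \<open>le\<close> makes nonpositive, so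
    \<open>h\<close> never exceeds its initial value \<open>c\<close>.\<close>
  define h where "h = (\<lambda>t. exp (- L * (t - a)) * (c + L * R t))"
  have R: "(R has_real_derivative d s) (at s within {a..b})" if "s \<in> {a..b}" for s
    unfolding R_def using integral_has_real_derivative[OF d that] .
  have h: "(h has_real_derivative exp (- L * (s - a)) * L * (d s - (c + L * R s)))
      (at s within {a..b})" if "s \<in> {a..b}" for s
    unfolding h_def using R[OF that]
    by (auto intro!: derivative_eq_intros simp: algebra_simps)
  have "h t \<le> h a"
  proof (rule DERIV_nonpos_imp_decreasing_open[of a t h])
    show "a \<le> t" using t by simp
    fix s assume s: "a < s" "s < t"
    then have s': "s \<in> {a..b}" using t by auto
    have "at s within {a..b} = at s" using s t by (intro at_within_interior) auto
    moreover have "exp (- L * (s - a)) * L * (d s - (c + L * R s)) \<le> 0"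
      using le[OF s'] L unfolding R_def by (intro mult_nonneg_nonpos) auto
    ultimately show "\<exists>y. DERIV h s :> y \<and> y \<le> 0"
      using h[OF s'] by auto
  next
    have "continuous_on {a..b} h"
      using h by (intro DERIV_continuous_on) auto
    then show "continuous_on {a..t} h"
      by (rule continuous_on_subset) (use t in auto)
  qed
  then have "exp (- L * (t - a)) * (c + L * R t) \<le> c"
    by (simp add: h_def R_def)
  then have "c + L * R t \<le> c * exp (L * (t - a))"
    using mult_left_mono[of "exp (- (L * (t - a))) * (c + L * R t)" c "exp (L * (t - a))"]
    by (simp add: mult.assoc[symmetric] mult_exp_exp) (simp add: mult.commute)
  with le[OF t] show ?thesis unfolding R_def by simp
qed

lemma continuous_on_slice:
  assumes "continuous_on (A \<times> Q) (\<lambda>(s, q). h s q)" "q \<in> Q"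
  shows "continuous_on A (\<lambda>s. h s q)"
proof -
  have "continuous_on A ((\<lambda>(s, q). h s q) \<circ> (\<lambda>s. (s, q)))"
    using assms by (intro continuous_on_compose) (auto intro!: continuous_intros elim: continuous_on_subset)
  then show ?thesis by (simp add: o_def)
qed

lemma continuous_on_indefinite_integral_param:
  fixes h :: "real \<Rightarrow> 'q::topological_space \<Rightarrow> 'a::banach"
  assumes h: "continuous_on ({a..b} \<times> Q) (\<lambda>(s, q). h s q)"
  shows "continuous_on ({a..b} \<times> Q) (\<lambda>(t, q). integral {a..t} (\<lambda>s. h s q))"
proof -
  \<comment> \<open>Rescaling to a fixed interval makes the end point \<open>t\<close> an ordinary parameter.\<close>
  have eq: "integral {a..t} (\<lambda>s. h s q) =
      (t - a) *\<^sub>R integral (cbox 0 1) (\<lambda>r. h ((t - a) * r + a) q)"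
    if t: "t \<in> {a..b}" and q: "q \<in> Q" for t q
  proof (cases "t = a")
    case False
    with t have m: "t - a > 0" by simp
    have "continuous_on {a..t} (\<lambda>s. h s q)"
      using continuous_on_slice[OF h q] by (rule continuous_on_subset) (use t in auto)
    then have "((\<lambda>s. h s q) has_integral integral {a..t} (\<lambda>s. h s q)) (cbox a t)"
      by (simp add: integrable_continuous_real integrable_integral)
    from has_integral_affinity'[OF this m, of a]
    have "((\<lambda>r. h ((t - a) * r + a) q) has_integral
        integral {a..t} (\<lambda>s. h s q) /\<^sub>R (t - a)) (cbox 0 1)"
      using m by simp
    then show ?thesis
      using m by (simp add: integral_unique)
  qed simp
  have "continuous_on (({a..b} \<times> Q) \<times> cbox 0 1)
      ((\<lambda>(s, q). h s q) \<circ> (\<lambda>(z, r). ((fst z - a) * r + a, snd z)))"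
  proof (rule continuous_on_compose)
    show "continuous_on (({a..b} \<times> Q) \<times> cbox 0 1) (\<lambda>(z, r). ((fst z - a) * r + a, snd z))"
      by (auto simp: split_def intro!: continuous_intros)
    have "(t - a) * r + a \<in> {a..b}" if "t \<in> {a..b}" "r \<in> {0..1}" for t r
    proof -
      have "(t - a) * r \<le> t - a" "0 \<le> (t - a) * r"
        using that by (auto intro!: mult_left_le)
      then show ?thesis using that by auto
    qed
    then show "continuous_on ((\<lambda>(z, r). ((fst z - a) * r + a, snd z)) ` (({a..b} \<times> Q) \<times> cbox 0 1))
        (\<lambda>(s, q). h s q)"
      by (intro continuous_on_subset[OF h]) auto
  qed
  then have "continuous_on (({a..b} \<times> Q) \<times> cbox 0 1) (\<lambda>(z, r). h ((fst z - a) * r + a) (snd z))"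
    by (simp add: o_def split_def)
  from integral_continuous_on_param[OF this]
  have "continuous_on ({a..b} \<times> Q)
      (\<lambda>z. (fst z - a) *\<^sub>R integral (cbox 0 1) (\<lambda>r. h ((fst z - a) * r + a) (snd z)))"
    by (intro continuous_intros)
  then show ?thesis
    by (rule continuous_on_eq) (auto simp: eq)
qed

text \<open>By a Lebesgue number argument each ball of radius \<open>r\<close> about a point of
  \<open>C\<close> lies in one of finitely many sets on which \<open>h\<close> is Lipschitz, and the
  sum of their constants serves for all of them. Only \<open>x\<close> is confined to
  \<open>C\<close>: the estimate is meant for a tube around a trajectory, with \<open>y\<close> on a
  neighbouring trajectory.\<close>

lemma compact_locally_lipschitz:
  assumes h: "locally_lipschitz_on UNIV h" and C: "compact C"
  obtains r L where "r > 0" "L \<ge> 0"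
    "\<And>x y. x \<in> C \<Longrightarrow> dist x y < r \<Longrightarrow> dist (h x) (h y) \<le> L * dist x y"
proof -
  have "\<exists>U. open U \<and> c \<in> U \<and> (\<exists>L. L-lipschitz_on U h)" for c
  proof -
    obtain u L where "u > 0" "L-lipschitz_on (cball c u) h"
      using h unfolding locally_lipschitz_on_def by (metis UNIV_I Int_UNIV_right)
    then have "L-lipschitz_on (ball c u) h"
      by (meson ball_subset_cball lipschitz_on_subset)
    with \<open>u > 0\<close> show ?thesis by (meson centre_in_ball open_ball)
  qed
  then obtain U where U: "\<And>c. open (U c)" "\<And>c. c \<in> U c" "\<And>c. \<exists>L. L-lipschitz_on (U c) h"
    by metis
  then obtain K where K: "\<And>c. (K c)-lipschitz_on (U c) h" by metis
  obtain D where D: "D \<subseteq> C" "finite D" "C \<subseteq> (\<Union>c\<in>D. U c)"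
    using compactE_image[OF C, of C U] U by blast
  obtain r where r: "r > 0" "\<And>x. x \<in> C \<Longrightarrow> \<exists>G\<in>U ` D. ball x r \<subseteq> G"
    using Heine_Borel_lemma[OF C, of "U ` D"] D U by blast
  show ?thesis
  proof (rule that[OF r(1), of "\<Sum>c\<in>D. K c"])
    have K0: "0 \<le> K c" for c using K by (rule lipschitz_on_nonneg)
    show "0 \<le> (\<Sum>c\<in>D. K c)" using K0 by (intro sum_nonneg)
    fix x y assume x: "x \<in> C" and y: "dist x y < r"
    obtain c where c: "c \<in> D" "ball x r \<subseteq> U c" using r(2)[OF x] by blast
    have "x \<in> ball x r" "y \<in> ball x r" using r(1) y by auto
    then have "dist (h x) (h y) \<le> K c * dist x y"
      using lipschitz_onD[OF K] c by blast
    also have "\<dots> \<le> (\<Sum>c\<in>D. K c) * dist x y"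
      using c D K0 by (intro mult_right_mono member_le_sum) auto
    finally show "dist (h x) (h y) \<le> (\<Sum>c\<in>D. K c) * dist x y" .
  qed
qed

lemma locally_lipschitz_on_UNIV_imp_continuous_on:
  assumes "locally_lipschitz_on UNIV h"
  shows "continuous_on S h"
proof -
  have "isCont h s" for s
  proof -
    obtain u L where u: "u > 0" and L: "L-lipschitz_on (cball s u) h"
      using assms unfolding locally_lipschitz_on_def by (metis UNIV_I Int_UNIV_right)
    have "continuous_on (ball s u) h"
      using lipschitz_on_continuous_on[OF L] by (rule continuous_on_subset) auto
    then show ?thesis using u by (simp add: continuous_on_eq_continuous_at)
  qed
  then show ?thesis by (simp add: continuous_at_imp_continuous_on)
qed

section \<open>Comparison and boundedness of solutions\<close>

text \<open>The constant \<open>K\<close> absorbs a difference of parameters in the two right-hand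
  sides. Integrated over time it contributes at most \<open>K * (b - a)\<close>, which joins the
  initial difference as the constant in Gronwall's inequality. For \<open>K = 0\<close> and equal
  initial values this is uniqueness.\<close>

lemma norm_diff_bound_if_derivative_diff_bound:
  fixes u v :: "real \<Rightarrow> 'a::banach"
  assumes u: "\<And>s. s \<in> {a..b} \<Longrightarrow> (u has_vector_derivative u' s) (at s within {a..b})"
    and v: "\<And>s. s \<in> {a..b} \<Longrightarrow> (v has_vector_derivative v' s) (at s within {a..b})"
    and le: "\<And>s. s \<in> {a..b} \<Longrightarrow> norm (u' s - v' s) \<le> K + L * norm (u s - v s)"
    and "0 \<le> K" "0 \<le> L" and t: "t \<in> {a..b}"
  shows "norm (u t - v t) \<le> (norm (u a - v a) + K * (b - a)) * exp (L * (t - a))"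
proof (rule gronwall_integral[OF _ \<open>0 \<le> L\<close> _ t])
  have "continuous_on {a..b} u" "continuous_on {a..b} v"
    using continuous_on_vector_derivative[OF u] continuous_on_vector_derivative[OF v] by blast+
  then show d: "continuous_on {a..b} (\<lambda>s. norm (u s - v s))"
    by (intro continuous_intros)
  fix t assume t: "t \<in> {a..b}"
  have "((\<lambda>s. u' s - v' s) has_integral (u t - v t) - (u a - v a)) {a..t}"
  proof (rule fundamental_theorem_of_calculus)
    fix s assume s: "s \<in> {a..t}"
    then have "((\<lambda>s. u s - v s) has_vector_derivative u' s - v' s) (at s within {a..b})"
      using t by (intro has_vector_derivative_diff u v) auto
    then show "((\<lambda>s. u s - v s) has_vector_derivative u' s - v' s) (at s within {a..t})"
      by (rule has_vector_derivative_within_subset) (use t in auto)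
  qed (use t in auto)
  note int = this
  have cont: "continuous_on {a..t} (\<lambda>s. norm (u s - v s))"
    using d by (rule continuous_on_subset) (use t in auto)
  have i: "(\<lambda>s. norm (u s - v s)) integrable_on {a..t}"
    using cont by (rule integrable_continuous_real)
  have "norm (integral {a..t} (\<lambda>s. u' s - v' s)) \<le> integral {a..t} (\<lambda>s. K + L * norm (u s - v s))"
  proof (rule integral_norm_bound_integral)
    show "(\<lambda>s. u' s - v' s) integrable_on {a..t}" using int by blast
    show "(\<lambda>s. K + L * norm (u s - v s)) integrable_on {a..t}"
      by (intro integrable_continuous_real continuous_on_add continuous_on_mult continuous_on_const cont)
  qed (use le t in auto)
  also have "integral {a..t} (\<lambda>s. K + L * norm (u s - v s)) =
      K * (t - a) + L * integral {a..t} (\<lambda>s. norm (u s - v s))"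
    using t integrable_cmul[OF i, of L] by (subst integral_add) auto
  also have "\<dots> \<le> K * (b - a) + L * integral {a..t} (\<lambda>s. norm (u s - v s))"
    using t \<open>0 \<le> K\<close> by (auto intro: mult_left_mono)
  finally have "norm ((u t - v t) - (u a - v a)) \<le> \<dots>"
    using int by (simp add: integral_unique)
  then show "norm (u t - v t) \<le>
      norm (u a - v a) + K * (b - a) + L * integral {a..t} (\<lambda>s. norm (u s - v s))"
    using norm_triangle_sub[of "u t - v t" "u a - v a"] by linarith
qed

text \<open>The Lipschitz estimate is available only within distance \<open>r\<close> of the compact
  trajectory of \<open>q0\<close>, hence only as long as the neighbouring trajectory stays there,
  which is part of what is to be shown. Continuity in time breaks the circle: as long as the
  distance of the states is at most \<open>r / 2\<close>, Gronwall's inequality improves the bound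
  to \<open>r / 4\<close>, so \<open>r / 2\<close> is never reached.\<close>

lemma solutions_locally_bounded:
  fixes X :: "real \<Rightarrow> 'q::metric_space \<Rightarrow> 'a::banach"
  assumes F: "locally_lipschitz_on UNIV (\<lambda>(t, q, y). F t q y)"
    and x0: "continuous_on Q x0"
    and init: "\<And>q. q \<in> Q \<Longrightarrow> X t0 q = x0 q"
    and X: "\<And>q t. q \<in> Q \<Longrightarrow> t \<in> {t0..tf} \<Longrightarrow>
      ((\<lambda>s. X s q) has_vector_derivative F t q (X t q)) (at t within {t0..tf})"
    and q0: "q0 \<in> Q"
  shows "\<exists>\<delta>>0. \<exists>B. \<forall>q\<in>Q. dist q q0 < \<delta> \<longrightarrow> (\<forall>t\<in>{t0..tf}. norm (X t q) \<le> B)"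
proof -
  have cX: "continuous_on {t0..tf} (\<lambda>s. X s q)" if "q \<in> Q" for q
    using X[OF that] by (rule continuous_on_vector_derivative)
  have "compact ((\<lambda>s. (s, q0, X s q0)) ` {t0..tf})"
    by (intro compact_continuous_image continuous_intros cX q0) auto
  from compact_locally_lipschitz[OF F this] obtain r L where r: "r > 0" and L: "L \<ge> 0"
    and FL: "\<And>s q y. s \<in> {t0..tf} \<Longrightarrow> dist (s, q0, X s q0) (s, q, y) < r \<Longrightarrow>
      dist (F s q0 (X s q0)) (F s q y) \<le> L * dist (s, q0, X s q0) (s, q, y)"
    by (smt (verit, ccfv_threshold) case_prod_conv image_eqI)
  have pd: "dist (s, q0, X s q0) (s, q, y) \<le> dist q q0 + dist y (X s q0)" for s q y
    by (simp add: dist_Pair_Pair dist_commute sqrt_sum_squares_le_sum)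
  \<comment> \<open>The maximum keeps \<open>T\<close> nonnegative when the time interval is
    empty.\<close>
  define T where "T = max 0 (tf - t0)"
  have T: "T \<ge> 0" by (simp add: T_def)
  have LT: "1 + L * T > 0" using L T by (simp add: add_pos_nonneg)
  define Z where "Z = (1 + L * T) * exp (L * T)"
  \<comment> \<open>\<open>\<eta>\<close> solves
    \<open>(\<eta> + L * \<eta> * T) * exp (L * T) = r / 4\<close>: it is the admissible size both
    of the initial difference and of the parameter difference, the latter entering the derivative
    with factor \<open>L\<close>.\<close>
  define \<eta> where "\<eta> = r / (4 * Z)"
  have Z: "Z > 0" using LT by (simp add: Z_def)
  have "(\<eta> + L * \<eta> * T) * exp (L * T) = \<eta> * Z"
    by (simp add: Z_def algebra_simps)
  then have \<eta>: "\<eta> > 0" "(\<eta> + L * \<eta> * T) * exp (L * T) = r / 4"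
    using r Z by (simp_all add: \<eta>_def)
  obtain \<delta>1 where \<delta>1: "\<delta>1 > 0" "\<And>q. q \<in> Q \<Longrightarrow> dist q q0 < \<delta>1 \<Longrightarrow> dist (x0 q) (x0 q0) < \<eta>"
    using x0 q0 \<eta>(1) unfolding continuous_on_iff by metis
  \<comment> \<open>\<open>\<delta>1\<close> controls the initial values and \<open>\<eta>\<close>
    the parameter difference; \<open>r / 2\<close>, together with a state difference of at most
    \<open>r / 2\<close>, keeps the total distance strictly below \<open>r\<close>.\<close>
  define \<delta> where "\<delta> = min \<delta>1 (min \<eta> (r / 2))"
  obtain B where "\<forall>y \<in> (\<lambda>s. X s q0) ` {t0..tf}. norm y \<le> B"
    using compact_imp_bounded[OF compact_continuous_image[OF cX[OF q0] compact_Icc]]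
    unfolding bounded_iff by blast
  then have B: "norm (X t q0) \<le> B" if "t \<in> {t0..tf}" for t
    using that by blast
  have "norm (X t q) \<le> B + r" if q: "q \<in> Q" "dist q q0 < \<delta>" and t: "t \<in> {t0..tf}" for q t
  proof -
    define d where "d = (\<lambda>s. norm (X s q - X s q0))"
    have cd: "continuous_on {t0..tf} d"
      unfolding d_def by (intro continuous_intros cX q q0)
    have step: "d \<tau> \<le> r / 4" if \<tau>: "\<tau> \<in> {t0..tf}" and le: "\<And>s. s \<in> {t0..\<tau>} \<Longrightarrow> d s \<le> r / 2" for \<tau>
    proof -
      have "d \<tau> \<le> (d t0 + L * \<eta> * (\<tau> - t0)) * exp (L * (\<tau> - t0))"
        unfolding d_def
      proof (rule norm_diff_bound_if_derivative_diff_bound)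
        fix s assume s: "s \<in> {t0..\<tau>}"
        then have s': "s \<in> {t0..tf}" using \<tau> by auto
        show "((\<lambda>s. X s q) has_vector_derivative F s q (X s q)) (at s within {t0..\<tau>})"
          "((\<lambda>s. X s q0) has_vector_derivative F s q0 (X s q0)) (at s within {t0..\<tau>})"
          using \<tau> by (auto intro!: has_vector_derivative_within_subset[OF X[OF q(1) s']]
              has_vector_derivative_within_subset[OF X[OF q0 s']])
        have "dist (s, q0, X s q0) (s, q, X s q) \<le> \<eta> + d s"
          using pd[of s q "X s q"] q(2) by (simp add: d_def dist_norm \<delta>_def)
        moreover have "dist (s, q0, X s q0) (s, q, X s q) < r"
          using pd[of s q "X s q"] q(2) le[OF s] by (simp add: d_def dist_norm \<delta>_def)
        ultimately have "dist (F s q0 (X s q0)) (F s q (X s q)) \<le> L * (\<eta> + d s)"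
          using FL[OF s'] L by (meson mult_left_mono order_trans)
        then show "norm (F s q (X s q) - F s q0 (X s q0)) \<le> L * \<eta> + L * norm (X s q - X s q0)"
          by (simp add: d_def dist_norm norm_minus_commute distrib_left)
      qed (use \<tau> L \<eta> in auto)
      also have "\<dots> \<le> (\<eta> + L * \<eta> * T) * exp (L * T)"
      proof (rule mult_mono)
        have \<tau>T: "\<tau> - t0 \<le> T" using \<tau> by (simp add: T_def)
        have "d t0 \<le> \<eta>"
          using \<delta>1(2)[of q] q q0 by (simp add: d_def init dist_norm \<delta>_def)
        moreover have "L * \<eta> * (\<tau> - t0) \<le> L * \<eta> * T"
          using \<tau>T L \<eta> by (intro mult_left_mono) auto
        ultimately show "d t0 + L * \<eta> * (\<tau> - t0) \<le> \<eta> + L * \<eta> * T" by simp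
        have "L * (\<tau> - t0) \<le> L * T" using \<tau>T L by (rule mult_left_mono)
        then show "exp (L * (\<tau> - t0)) \<le> exp (L * T)" by simp
      qed (use L \<eta> T in auto)
      finally show ?thesis using \<eta> by simp
    qed
    \<comment> \<open>At the first time \<open>\<tau>\<close> where \<open>d\<close> reaches \<open>r / 2\<close>, Gronwall gives \<open>d \<tau> \<le> r / 4\<close>.\<close>
    have "d t < r / 2"
    proof (rule ccontr)
      assume "\<not> d t < r / 2"
      define S where "S = {t0..tf} \<inter> d -` {r / 2..}"
      have "closed S"
        unfolding S_def by (intro continuous_closed_preimage cd) auto
      then have "compact ({t0..tf} \<inter> S)"
        by (intro compact_Int_closed) auto
      then have "compact S" by (simp add: S_def Int_absorb1)
      moreover have "t \<in> S" using t \<open>\<not> d t < r / 2\<close> by (auto simp: S_def)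
      ultimately obtain \<tau> where \<tau>: "\<tau> \<in> S" "\<And>s. s \<in> S \<Longrightarrow> \<tau> \<le> s"
        using compact_attains_inf[of S] by blast
      have \<tau>I: "\<tau> \<in> {t0..tf}" "r / 2 \<le> d \<tau>" using \<tau> by (auto simp: S_def)
      have "d t0 \<le> r / 4"
      proof (rule step)
        have "d t0 \<le> \<eta>"
          using \<delta>1(2)[of q] q q0 by (simp add: d_def init dist_norm \<delta>_def)
        also have "\<dots> \<le> r / 4"
        proof -
          have "\<eta> * 1 \<le> (\<eta> + L * \<eta> * T) * exp (L * T)"
            using \<eta>(1) L T by (intro mult_mono) auto
          then show ?thesis using \<eta> by simp
        qed
        finally show "d s \<le> r / 2" if "s \<in> {t0..t0}" for s using that r by simp
      qed (use t in auto)
      \<comment> \<open>Membership in \<open>S\<close> bounds \<open>d \<tau>\<close> only from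
        below, whereas \<open>step\<close> at \<open>\<tau>\<close> also needs
        \<open>d \<tau> \<le> r / 2\<close>. A time up to \<open>\<tau>\<close> at which
        \<open>d\<close> equals \<open>r / 2\<close> must be \<open>\<tau>\<close> itself, by
        minimality.\<close>
      then obtain s where s: "t0 \<le> s" "s \<le> \<tau>" "d s = r / 2"
        using IVT'[of d t0 "r / 2" \<tau>] \<tau>I r continuous_on_subset[OF cd, of "{t0..\<tau>}"] by auto
      then have "s \<in> S" using \<tau>I by (auto simp: S_def)
      then have "d \<tau> = r / 2" using \<tau>(2)[of s] s by auto
      moreover have "d \<tau> \<le> r / 4"
      proof (rule step[OF \<tau>I(1)])
        fix s assume s: "s \<in> {t0..\<tau>}"
        show "d s \<le> r / 2"
        proof (cases "s = \<tau>")
          case False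
          then have "s \<notin> S" using \<tau>(2)[of s] s by auto
          then show ?thesis using s \<tau>I by (auto simp: S_def)
        qed (use \<open>d \<tau> = r / 2\<close> in simp)
      qed
      ultimately show False using r by simp
    qed
    then show ?thesis
      using B[OF t] norm_triangle_sub[of "X t q" "X t q0"] r unfolding d_def by linarith
  qed
  moreover have "\<delta> > 0" using \<delta>1 \<eta> r by (simp add: \<delta>_def)
  ultimately show ?thesis by blast
qed

text \<open>Finitely many of the neighbourhoods with local bounds cover \<open>Q\<close>. This
  replaces the usual argument that a continuous image of a compact set is bounded, since continuity
  of \<open>X\<close> in \<open>q\<close> is not at hand.\<close>

lemma solutions_bounded:
  fixes X :: "real \<Rightarrow> 'q::metric_space \<Rightarrow> 'a::banach"
  assumes F: "locally_lipschitz_on UNIV (\<lambda>(t, q, y). F t q y)"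
    and x0: "continuous_on Q x0" and Q: "compact Q"
    and init: "\<And>q. q \<in> Q \<Longrightarrow> X t0 q = x0 q"
    and X: "\<And>q t. q \<in> Q \<Longrightarrow> t \<in> {t0..tf} \<Longrightarrow>
      ((\<lambda>s. X s q) has_vector_derivative F t q (X t q)) (at t within {t0..tf})"
  obtains B where "\<And>t q. t \<in> {t0..tf} \<Longrightarrow> q \<in> Q \<Longrightarrow> norm (X t q) \<le> B"
proof -
  have "\<forall>q0\<in>Q. \<exists>\<delta> B. \<delta> > 0 \<and> (\<forall>q\<in>Q. dist q q0 < \<delta> \<longrightarrow> (\<forall>t\<in>{t0..tf}. norm (X t q) \<le> B))"
    using solutions_locally_bounded[where X = X, OF F x0 init X] by blast
  then obtain \<delta> B where \<delta>: "\<And>q0. q0 \<in> Q \<Longrightarrow> \<delta> q0 > 0"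
    and B: "\<And>q0 q t. q0 \<in> Q \<Longrightarrow> q \<in> Q \<Longrightarrow> dist q q0 < \<delta> q0 \<Longrightarrow> t \<in> {t0..tf} \<Longrightarrow>
      norm (X t q) \<le> B q0"
    by metis
  obtain D where D: "D \<subseteq> Q" "finite D" "Q \<subseteq> (\<Union>c\<in>D. ball c (\<delta> c))"
    using compactE_image[OF Q, of Q "\<lambda>c. ball c (\<delta> c)"] \<delta> by force
  show ?thesis
  proof (rule that)
    fix t q assume t: "t \<in> {t0..tf}" and q: "q \<in> Q"
    then obtain c where c: "c \<in> D" "dist q c < \<delta> c"
      using D by (auto simp: dist_commute)
    then have "norm (X t q) \<le> \<bar>B c\<bar>" using B[of c q t] D q t by fastforce
    also have "\<dots> \<le> (\<Sum>c\<in>D. \<bar>B c\<bar>)" using c D by (intro member_le_sum) auto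
    finally show "norm (X t q) \<le> (\<Sum>c\<in>D. \<bar>B c\<bar>)" .
  qed
qed

section \<open>Picard iteration with a parameter\<close>

text \<open>Fixed points are the solutions of the integral form of the initial value problem. The
  operator acts on functions of time and parameter together, because convexity and the bounds
  concern the dependence on \<open>q\<close>.\<close>

definition picard ::
    "real \<Rightarrow> ('q \<Rightarrow> 'a) \<Rightarrow> (real \<Rightarrow> 'q \<Rightarrow> 'a \<Rightarrow> 'a) \<Rightarrow> (real \<Rightarrow> 'q \<Rightarrow> 'a) \<Rightarrow> real \<Rightarrow> 'q \<Rightarrow> 'a::banach"
  where "picard a c F u t q = c q + integral {a..t} (\<lambda>s. F s q (u s q))"

lemma continuous_on_along:
  fixes F :: "real \<Rightarrow> 'q::topological_space \<Rightarrow> 'a::topological_space \<Rightarrow> 'b::topological_space"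
  assumes F: "continuous_on (I \<times> Q \<times> UNIV) (\<lambda>(t, q, y). F t q y)"
    and u: "continuous_on (I \<times> Q) (\<lambda>(t, q). u t q)"
  shows "continuous_on (I \<times> Q) (\<lambda>(t, q). F t q (u t q))"
proof -
  have "continuous_on (I \<times> Q) ((\<lambda>(t, q, y). F t q y) \<circ> (\<lambda>z. (fst z, snd z, u (fst z) (snd z))))"
  proof (rule continuous_on_compose)
    show "continuous_on (I \<times> Q) (\<lambda>z. (fst z, snd z, u (fst z) (snd z)))"
      using u by (intro continuous_intros) (simp add: split_def)
    show "continuous_on ((\<lambda>z. (fst z, snd z, u (fst z) (snd z))) ` (I \<times> Q)) (\<lambda>(t, q, y). F t q y)"
      using F by (rule continuous_on_subset) auto
  qed
  then show ?thesis by (simp add: o_def split_def)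
qed

text \<open>Joint continuity in time and parameter, rather than continuity in time for each
  parameter, is what \<open>f_relaxations\<close> asks of the functions inserted into the right-hand
  sides.\<close>

lemma continuous_on_picard:
  fixes F :: "real \<Rightarrow> 'q::topological_space \<Rightarrow> 'a::banach \<Rightarrow> 'a"
  assumes F: "continuous_on ({a..b} \<times> Q \<times> UNIV) (\<lambda>(t, q, y). F t q y)"
    and c: "continuous_on Q c"
    and u: "continuous_on ({a..b} \<times> Q) (\<lambda>(t, q). u t q)"
  shows "continuous_on ({a..b} \<times> Q) (\<lambda>(t, q). picard a c F u t q)"
proof -
  have "continuous_on ({a..b} \<times> Q) (\<lambda>z. c (snd z))"
    by (rule continuous_on_compose2[OF c]) (auto intro: continuous_intros)
  with continuous_on_indefinite_integral_param[OF continuous_on_along[OF F u]]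
  show ?thesis
    unfolding picard_def split_def by (rule continuous_on_add[rotated])
qed

lemma picard_integrable:
  fixes F :: "real \<Rightarrow> 'q::topological_space \<Rightarrow> 'a::banach \<Rightarrow> 'a"
  assumes F: "continuous_on ({a..b} \<times> Q \<times> UNIV) (\<lambda>(t, q, y). F t q y)"
    and u: "continuous_on ({a..b} \<times> Q) (\<lambda>(t, q). u t q)"
    and "t \<in> {a..b}" "q \<in> Q"
  shows "(\<lambda>s. F s q (u s q) ) integrable_on {a..t}"
proof (rule integrable_continuous_real)
  show "continuous_on {a..t} (\<lambda>s. F s q (u s q))"
    using continuous_on_slice[OF continuous_on_along[OF F u] \<open>q \<in> Q\<close>]
    by (rule continuous_on_subset) (use \<open>t \<in> {a..b}\<close> in auto)
qed

text \<open>The bound \<open>e\<close> may vary with time so that an exponential weight can be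
  integrated in the contraction estimate; a constant \<open>e\<close> serves when the limit is shown
  to be a fixed point.\<close>

lemma norm_picard_diff_le:
  fixes F :: "real \<Rightarrow> 'q::topological_space \<Rightarrow> 'a::banach \<Rightarrow> 'a"
  assumes F: "continuous_on ({a..b} \<times> Q \<times> UNIV) (\<lambda>(t, q, y). F t q y)"
    and L: "\<And>t q y z. t \<in> {a..b} \<Longrightarrow> q \<in> Q \<Longrightarrow> norm (F t q y - F t q z) \<le> L * norm (y - z)"
    and u: "continuous_on ({a..b} \<times> Q) (\<lambda>(t, q). u t q)"
    and v: "continuous_on ({a..b} \<times> Q) (\<lambda>(t, q). v t q)"
    and t: "t \<in> {a..b}" and q: "q \<in> Q" and "0 \<le> L"
    and le: "\<And>s. s \<in> {a..t} \<Longrightarrow> norm (u s q - v s q) \<le> e s"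
    and e: "e integrable_on {a..t}"
  shows "norm (picard a c F u t q - picard a c F v t q) \<le> L * integral {a..t} e"
proof -
  note iu = picard_integrable[OF F u t q] and iv = picard_integrable[OF F v t q]
  have "picard a c F u t q - picard a c F v t q =
      integral {a..t} (\<lambda>s. F s q (u s q) - F s q (v s q))"
    by (simp add: picard_def integral_diff[OF iu iv])
  also have "norm \<dots> \<le> integral {a..t} (\<lambda>s. L * e s)"
  proof (rule integral_norm_bound_integral)
    show "(\<lambda>s. F s q (u s q) - F s q (v s q)) integrable_on {a..t}"
      by (intro integrable_diff iu iv)
    show "(\<lambda>s. L * e s) integrable_on {a..t}"
      using integrable_cmul[OF e, of L] by simp
    fix s assume s: "s \<in> {a..t}"
    have "norm (F s q (u s q) - F s q (v s q)) \<le> L * norm (u s q - v s q)"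
      using s t q by (intro L) auto
    also have "\<dots> \<le> L * e s"
      using le[OF s] \<open>0 \<le> L\<close> by (rule mult_left_mono)
    finally show "norm (F s q (u s q) - F s q (v s q)) \<le> L * e s" .
  qed
  finally show ?thesis by simp
qed

text \<open>Existence of a fixed point alone would not do: its relaxation properties are inherited
  from the iterates, so convergence from the prescribed start \<open>u0\<close> is part of the
  conclusion.\<close>

lemma picard_iteration:
  fixes F :: "real \<Rightarrow> 'q::topological_space \<Rightarrow> 'a::banach \<Rightarrow> 'a"
  assumes F: "continuous_on ({a..b} \<times> Q \<times> UNIV) (\<lambda>(t, q, y). F t q y)"
    and L: "\<And>t q y z. t \<in> {a..b} \<Longrightarrow> q \<in> Q \<Longrightarrow> norm (F t q y - F t q z) \<le> L * norm (y - z)"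
    and "0 < L" and Q: "compact Q" and c: "continuous_on Q c"
    and u0: "continuous_on ({a..b} \<times> Q) (\<lambda>(t, q). u0 t q)"
  obtains u where "continuous_on ({a..b} \<times> Q) (\<lambda>(t, q). u t q)"
    "\<And>t q. t \<in> {a..b} \<Longrightarrow> q \<in> Q \<Longrightarrow> picard a c F u t q = u t q"
    "\<And>t q. t \<in> {a..b} \<Longrightarrow> q \<in> Q \<Longrightarrow> (\<lambda>n. (picard a c F ^^ n) u0 t q) \<longlonglongrightarrow> u t q"
proof -
  define U where "U n = (picard a c F ^^ n) u0" for n
  have U0: "U 0 = u0" and USuc: "U (Suc n) = picard a c F (U n)" for n
    by (simp_all add: U_def)
  have cU: "continuous_on ({a..b} \<times> Q) (\<lambda>(t, q). U n t q)" for n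
    by (induction n) (simp_all add: U0 u0 USuc continuous_on_picard[OF F c])
  have "continuous_on ({a..b} \<times> Q) (\<lambda>z. U 1 (fst z) (snd z) - U 0 (fst z) (snd z))"
    using cU[of 0] cU[of 1] by (intro continuous_intros) (simp_all add: split_def)
  then have "bounded ((\<lambda>z. U 1 (fst z) (snd z) - U 0 (fst z) (snd z)) ` ({a..b} \<times> Q))"
    by (intro compact_imp_bounded compact_continuous_image compact_Times Q) auto
  then obtain M0 where "\<And>z. z \<in> {a..b} \<times> Q \<Longrightarrow> norm (U 1 (fst z) (snd z) - U 0 (fst z) (snd z)) \<le> M0"
    unfolding bounded_iff by blast
  then have M0: "norm (U 1 t q - U 0 t q) \<le> M0" if "t \<in> {a..b}" "q \<in> Q" for t q
    using that by fastforce
  define M where "M = max 0 M0"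
  have M: "norm (U 1 t q - U 0 t q) \<le> M" if "t \<in> {a..b}" "q \<in> Q" for t q
    using M0[OF that] by (auto simp: M_def)
  have M_nonneg: "0 \<le> M" by (simp add: M_def)
  \<comment> \<open>In the norm weighted by \<open>exp (- 2 * L * (t - a))\<close> the Picard operator contracts by 1/2.\<close>
  have step: "norm (U (Suc n) t q - U n t q) \<le> M * (1 / 2) ^ n * exp (2 * L * (t - a))"
    if "t \<in> {a..b}" "q \<in> Q" for n t q
    using that
  proof (induction n arbitrary: t)
    case 0
    have "M * 1 \<le> M * exp (2 * L * (t - a))"
      using 0 \<open>0 < L\<close> M_nonneg by (intro mult_left_mono) auto
    with M[OF 0] show ?case by simp
  next
    case (Suc n)
    let ?e = "\<lambda>s. M * (1 / 2) ^ n * exp (2 * L * (s - a))"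
    let ?I = "M * (1 / 2) ^ n * exp (2 * L * (t - a)) / (2 * L)
        - M * (1 / 2) ^ n * exp (2 * L * (a - a)) / (2 * L)"
    have int: "(?e has_integral ?I) {a..t}"
      using Suc.prems \<open>0 < L\<close>
      by (intro fundamental_theorem_of_calculus)
        (auto simp: has_real_derivative_iff_has_vector_derivative[symmetric]
          intro!: derivative_eq_intros)
    have "norm (picard a c F (U (Suc n)) t q - picard a c F (U n) t q) \<le> L * integral {a..t} ?e"
    proof (rule norm_picard_diff_le[OF F L cU cU])
      show "?e integrable_on {a..t}" using int by blast
    qed (use Suc \<open>0 < L\<close> in auto)
    also have "\<dots> = L * ?I" using int by (simp only: integral_unique)
    \<comment> \<open>Integrating the weight divides it by \<open>2 * L\<close>, and the Lipschitz
      factor \<open>L\<close> leaves one half; the nonnegative term from the lower end point is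
      dropped.\<close>
    also have "\<dots> \<le> M * (1 / 2) ^ Suc n * exp (2 * L * (t - a))"
      using \<open>0 < L\<close> M_nonneg by (simp add: field_simps)
    finally have "norm (picard a c F (U (Suc n)) t q - picard a c F (U n) t q)
        \<le> M * (1 / 2) ^ Suc n * exp (2 * L * (t - a))" .
    then show ?case by (simp only: USuc)
  qed
  define K where "K = M * exp (2 * L * (b - a))"
  let ?D = "\<lambda>n (t, q). U (Suc n) t q - U n t q"
  have D: "norm (?D n z) \<le> K * (1 / 2) ^ n" if "z \<in> {a..b} \<times> Q" for n z
  proof -
    obtain t q where z: "z = (t, q)" "t \<in> {a..b}" "q \<in> Q" using \<open>z \<in> {a..b} \<times> Q\<close> by (elim SigmaE)
    note step[OF z(2,3), of n]
    also have "M * (1 / 2) ^ n * exp (2 * L * (t - a)) \<le> M * (1 / 2) ^ n * exp (2 * L * (b - a))"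
      using z \<open>0 < L\<close> M_nonneg by (intro mult_left_mono) auto
    finally show ?thesis by (simp add: z K_def mult_ac)
  qed
  \<comment> \<open>Writing the limit as a telescoping series of the increments lets the Weierstrass
    test give uniform convergence.\<close>
  define u where "u t q = U 0 t q + (\<Sum>n. ?D n (t, q))" for t q
  have series: "uniform_limit ({a..b} \<times> Q) (\<lambda>n z. \<Sum>i<n. ?D i z) (\<lambda>z. \<Sum>n. ?D n z) sequentially"
    using D by (rule Weierstrass_m_test) (auto intro!: summable_mult summable_geometric)
  have telescope: "(\<Sum>i<n. ?D i (t, q)) = U n t q - U 0 t q" for n t q
    using sum_lessThan_telescope[of "\<lambda>i. U i t q" n] by simp
  have close: "\<forall>\<^sub>F n in sequentially. \<forall>t\<in>{a..b}. \<forall>q\<in>Q. dist (U n t q) (u t q) < e"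
    if "e > 0" for e
    using uniform_limitD[OF series that]
  proof (rule eventually_mono, intro ballI)
    fix n t q
    assume n: "\<forall>z\<in>{a..b} \<times> Q. dist (\<Sum>i<n. ?D i z) (\<Sum>n. ?D n z) < e"
      and "t \<in> {a..b}" "q \<in> Q"
    then have "dist (\<Sum>i<n. ?D i (t, q)) (\<Sum>n. ?D n (t, q)) < e" by blast
    then show "dist (U n t q) (u t q) < e"
      unfolding telescope by (simp add: dist_norm u_def diff_diff_eq)
  qed
  then have "uniform_limit ({a..b} \<times> Q) (\<lambda>n (t, q). U n t q) (\<lambda>(t, q). u t q) sequentially"
    unfolding uniform_limit_iff by (auto elim!: eventually_mono)
  then have cu: "continuous_on ({a..b} \<times> Q) (\<lambda>(t, q). u t q)"
    using cU by (intro uniform_limit_theorem[OF always_eventually]) auto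
  have lim: "(\<lambda>n. U n t q) \<longlonglongrightarrow> u t q" if "t \<in> {a..b}" "q \<in> Q" for t q
    unfolding tendsto_iff using close that by (fast elim: eventually_mono)
  have fixpoint: "picard a c F u t q = u t q" if t: "t \<in> {a..b}" and q: "q \<in> Q" for t q
  proof -
    have "(\<lambda>n. picard a c F (U n) t q) \<longlonglongrightarrow> picard a c F u t q"
      unfolding tendsto_iff
    proof (intro allI impI)
      fix e :: real assume "e > 0"
      \<comment> \<open>Chosen so that \<open>L * (d * (b - a + 1))\<close> is \<open>e / 2\<close>;
        the summand 1 keeps the denominator positive when \<open>a = b\<close>.\<close>
      define d where "d = e / (2 * L * (b - a + 1))"
      have d: "d > 0" using \<open>e > 0\<close> \<open>0 < L\<close> t by (auto simp: d_def)
      from close[OF d] show "\<forall>\<^sub>F n in sequentially. dist (picard a c F (U n) t q) (picard a c F u t q) < e"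
      proof (rule eventually_mono)
        fix n assume n: "\<forall>t\<in>{a..b}. \<forall>q\<in>Q. dist (U n t q) (u t q) < d"
        have "norm (picard a c F (U n) t q - picard a c F u t q) \<le> L * integral {a..t} (\<lambda>s. d)"
          using n t q \<open>0 < L\<close>
          by (intro norm_picard_diff_le[OF F L cU cu]) (auto simp: dist_norm less_imp_le)
        also have "\<dots> \<le> L * (d * (b - a + 1))"
          using t d \<open>0 < L\<close> by (auto intro!: mult_left_mono)
        also have "\<dots> = e / 2" using t \<open>0 < L\<close> by (simp add: d_def)
        also have "\<dots> < e" using \<open>e > 0\<close> by simp
        finally show "dist (picard a c F (U n) t q) (picard a c F u t q) < e"
          by (simp add: dist_norm)
      qed
    qed
    moreover have "(\<lambda>n. picard a c F (U n) t q) \<longlonglongrightarrow> u t q"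
      using LIMSEQ_Suc[OF lim[OF t q]] by (simp add: USuc)
    ultimately show ?thesis by (rule LIMSEQ_unique)
  qed
  show ?thesis
    by (rule that[OF cu fixpoint lim[unfolded U_def]])
qed

section \<open>Stability of relaxations under integrals, sums and limits\<close>

lemma convex_on_integral:
  fixes h :: "real \<Rightarrow> 'q::real_vector \<Rightarrow> real"
  assumes h: "\<And>s. s \<in> {a..b} \<Longrightarrow> convex_on S (h s)" and "convex S"
    and int: "\<And>q. q \<in> S \<Longrightarrow> (\<lambda>s. h s q) integrable_on {a..b}"
  shows "convex_on S (\<lambda>q. integral {a..b} (\<lambda>s. h s q))"
  unfolding convex_on_def
proof (intro conjI ballI allI impI)
  fix x y u v assume xy: "x \<in> S" "y \<in> S" and uv: "0 \<le> u" "0 \<le> v" "u + v = (1::real)"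
  have iu: "(\<lambda>s. u * h s x) integrable_on {a..b}" "(\<lambda>s. v * h s y) integrable_on {a..b}"
    using integrable_cmul[OF int[OF xy(1)], of u] integrable_cmul[OF int[OF xy(2)], of v] by simp_all
  have "integral {a..b} (\<lambda>s. h s (u *\<^sub>R x + v *\<^sub>R y)) \<le> integral {a..b} (\<lambda>s. u * h s x + v * h s y)"
  proof (rule integral_le)
    show "(\<lambda>s. h s (u *\<^sub>R x + v *\<^sub>R y)) integrable_on {a..b}"
      using xy uv \<open>convex S\<close> by (intro int) (simp add: convexD)
    show "(\<lambda>s. u * h s x + v * h s y) integrable_on {a..b}"
      using iu by (rule integrable_add)
    fix s assume "s \<in> {a..b}"
    then show "h s (u *\<^sub>R x + v *\<^sub>R y) \<le> u * h s x + v * h s y"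
      using h xy uv unfolding convex_on_def by blast
  qed
  also have "\<dots> = u * integral {a..b} (\<lambda>s. h s x) + v * integral {a..b} (\<lambda>s. h s y)"
    using iu by (simp add: integral_add)
  finally show "integral {a..b} (\<lambda>s. h s (u *\<^sub>R x + v *\<^sub>R y)) \<le>
      u * integral {a..b} (\<lambda>s. h s x) + v * integral {a..b} (\<lambda>s. h s y)" .
qed fact

lemma relaxations_on_integral:
  fixes h :: "real \<Rightarrow> 'q::real_vector \<Rightarrow> real"
  assumes rel: "\<And>s. s \<in> {a..b} \<Longrightarrow> relaxations_on S (h s) (hcv s) (hcc s)" and "convex S"
    and int: "\<And>q. q \<in> S \<Longrightarrow> (\<lambda>s. h s q) integrable_on {a..b}"
      "\<And>q. q \<in> S \<Longrightarrow> (\<lambda>s. hcv s q) integrable_on {a..b}"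
      "\<And>q. q \<in> S \<Longrightarrow> (\<lambda>s. hcc s q) integrable_on {a..b}"
  shows "relaxations_on S (\<lambda>q. integral {a..b} (\<lambda>s. h s q))
    (\<lambda>q. integral {a..b} (\<lambda>s. hcv s q)) (\<lambda>q. integral {a..b} (\<lambda>s. hcc s q))"
proof -
  have "convex_on S (\<lambda>q. integral {a..b} (\<lambda>s. hcv s q))"
    using rel \<open>convex S\<close> int(2) by (intro convex_on_integral) (auto simp: relaxations_on_def)
  moreover have "convex_on S (\<lambda>q. integral {a..b} (\<lambda>s. - hcc s q))"
    using rel \<open>convex S\<close> int(3)
    by (intro convex_on_integral integrable_neg) (auto simp: relaxations_on_def concave_on_def)
  moreover have "integral {a..b} (\<lambda>s. hcv s q) \<le> integral {a..b} (\<lambda>s. h s q)"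
    "integral {a..b} (\<lambda>s. h s q) \<le> integral {a..b} (\<lambda>s. hcc s q)" if "q \<in> S" for q
    using rel int that by (auto intro!: integral_le simp: relaxations_on_def)
  ultimately show ?thesis
    by (simp add: relaxations_on_def concave_on_def)
qed

lemma relaxations_on_add:
  assumes "relaxations_on S h hcv hcc" "relaxations_on S k kcv kcc"
  shows "relaxations_on S (\<lambda>q. h q + k q) (\<lambda>q. hcv q + kcv q) (\<lambda>q. hcc q + kcc q)"
  using assms unfolding relaxations_on_def
  by (auto intro!: convex_on_add concave_on_add add_mono)

text \<open>The functions agree on \<open>S\<close> only, while convexity evaluates them at convex
  combinations; these stay in \<open>S\<close> because \<open>convex_on\<close> includes convexity
  of the set.\<close>

lemma relaxations_on_cong:
  assumes "relaxations_on S h hcv hcc"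
    and "\<And>q. q \<in> S \<Longrightarrow> h q = k q" "\<And>q. q \<in> S \<Longrightarrow> hcv q = kcv q" "\<And>q. q \<in> S \<Longrightarrow> hcc q = kcc q"
  shows "relaxations_on S k kcv kcc"
proof -
  have "convex S" using assms(1) by (auto simp: relaxations_on_def convex_on_def)
  then have "u *\<^sub>R x + v *\<^sub>R y \<in> S" if "x \<in> S" "y \<in> S" "0 \<le> u" "0 \<le> v" "u + v = 1" for u v x y
    using that by (simp add: convexD)
  with assms show ?thesis
    unfolding relaxations_on_def convex_on_def concave_on_iff by simp
qed

text \<open>Each required property is a non-strict inequality between values at finitely many
  points, so pointwise convergence preserves it.\<close>

lemma relaxations_on_lim:
  assumes rel: "\<And>n. relaxations_on S h (hcv n) (hcc n)"
    and cv: "\<And>q. q \<in> S \<Longrightarrow> (\<lambda>n. hcv n q) \<longlonglongrightarrow> kcv q"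
    and cc: "\<And>q. q \<in> S \<Longrightarrow> (\<lambda>n. hcc n q) \<longlonglongrightarrow> kcc q"
  shows "relaxations_on S h kcv kcc"
proof -
  have convex: "convex S" using rel[of 0] by (auto simp: relaxations_on_def convex_on_def)
  show ?thesis
    unfolding relaxations_on_def convex_on_def concave_on_iff
  proof (intro conjI ballI allI impI)
    fix x y and u v :: real assume xy: "x \<in> S" "y \<in> S" and uv: "0 \<le> u" "0 \<le> v" "u + v = 1"
    have mem: "u *\<^sub>R x + v *\<^sub>R y \<in> S" using xy uv convex by (simp add: convexD)
    show "kcv (u *\<^sub>R x + v *\<^sub>R y) \<le> u * kcv x + v * kcv y"
    proof (rule LIMSEQ_le[OF cv[OF mem]])
      show "(\<lambda>n. u * hcv n x + v * hcv n y) \<longlonglongrightarrow> u * kcv x + v * kcv y"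
        using xy by (intro tendsto_intros cv)
      show "\<exists>N. \<forall>n\<ge>N. hcv n (u *\<^sub>R x + v *\<^sub>R y) \<le> u * hcv n x + v * hcv n y"
        using rel xy uv unfolding relaxations_on_def convex_on_def by blast
    qed
    show "u * kcc x + v * kcc y \<le> kcc (u *\<^sub>R x + v *\<^sub>R y)"
    proof (rule LIMSEQ_le[OF _ cc[OF mem]])
      show "(\<lambda>n. u * hcc n x + v * hcc n y) \<longlonglongrightarrow> u * kcc x + v * kcc y"
        using xy by (intro tendsto_intros cc)
      show "\<exists>N. \<forall>n\<ge>N. u * hcc n x + v * hcc n y \<le> hcc n (u *\<^sub>R x + v *\<^sub>R y)"
        using rel xy uv unfolding relaxations_on_def concave_on_iff by blast
    qed
  next
    fix q assume q: "q \<in> S"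
    show "kcv q \<le> h q" "h q \<le> kcc q"
      using LIMSEQ_le_const2[OF cv[OF q]] LIMSEQ_le_const[OF cc[OF q]] rel q
      unfolding relaxations_on_def by blast+
  qed (use convex in auto)
qed

text \<open>By \<open>x'\<close>, the relaxed function \<open>x\<close> is \<open>x0\<close> plus
  the integral of its own derivative, the same form as a Picard iterate. Relaxations of the initial
  value and of the derivative at all earlier times therefore add up to relaxations of
  \<open>x\<close>. The convex and the concave part are the two components of one state.\<close>

lemma vec_relaxations_on_picard:
  fixes F :: "real \<Rightarrow> 'q::real_vector \<Rightarrow> (real^'n) \<times> (real^'n) \<Rightarrow> (real^'n) \<times> (real^'n)"
  assumes "convex Q"
    and rel0: "vec_relaxations_on Q x0 (\<lambda>q. fst (c q)) (\<lambda>q. snd (c q))"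
    and rel: "\<And>s. s \<in> {a..t} \<Longrightarrow>
      vec_relaxations_on Q (x' s) (\<lambda>q. fst (F s q (u s q))) (\<lambda>q. snd (F s q (u s q)))"
    and x': "\<And>q. q \<in> Q \<Longrightarrow> ((\<lambda>s. x' s q) has_integral x q - x0 q) {a..t}"
    and int: "\<And>q. q \<in> Q \<Longrightarrow> (\<lambda>s. F s q (u s q)) integrable_on {a..t}"
  shows "vec_relaxations_on Q x (\<lambda>q. fst (picard a c F u t q)) (\<lambda>q. snd (picard a c F u t q))"
  unfolding vec_relaxations_on_def
proof
  fix i
  let ?G = "\<lambda>s q. F s q (u s q)"
  have lin: "bounded_linear (\<lambda>y :: (real^'n) \<times> (real^'n). fst y $ i)"
    "bounded_linear (\<lambda>y :: (real^'n) \<times> (real^'n). snd y $ i)"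
    by (intro bounded_linear_compose[OF bounded_linear_vec_nth] bounded_linear_fst bounded_linear_snd)+
  note iG = integral_linear[OF int lin(1), unfolded o_def] integral_linear[OF int lin(2), unfolded o_def]
    integrable_linear[OF int lin(1), unfolded o_def] integrable_linear[OF int lin(2), unfolded o_def]
  have ix: "((\<lambda>s. x' s q $ i) has_integral x q $ i - x0 q $ i) {a..t}" if "q \<in> Q" for q
    using has_integral_linear[OF x'[OF that] bounded_linear_vec_nth[of i]] by (simp add: o_def)
  have "relaxations_on Q (\<lambda>q. integral {a..t} (\<lambda>s. x' s q $ i))
      (\<lambda>q. integral {a..t} (\<lambda>s. fst (?G s q) $ i)) (\<lambda>q. integral {a..t} (\<lambda>s. snd (?G s q) $ i))"
    using rel ix \<open>convex Q\<close> iG(3,4)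
    by (intro relaxations_on_integral) (auto simp: vec_relaxations_on_def)
  moreover have "relaxations_on Q (\<lambda>q. x0 q $ i) (\<lambda>q. fst (c q) $ i) (\<lambda>q. snd (c q) $ i)"
    using rel0 by (simp add: vec_relaxations_on_def)
  ultimately show "relaxations_on Q (\<lambda>q. x q $ i)
      (\<lambda>q. fst (picard a c F u t q) $ i) (\<lambda>q. snd (picard a c F u t q) $ i)"
    by (rule relaxations_on_cong[OF relaxations_on_add])
      (simp_all add: integral_unique[OF ix] picard_def iG)
qed

section \<open>Application to the auxiliary system\<close>

text \<open>Serves to regroup the arguments \<open>(t, p, w, y)\<close> as
  \<open>(t, (p, w), y)\<close>, which leaves the product distance unchanged.\<close>

lemma locally_lipschitz_on_isometry:
  assumes h: "locally_lipschitz_on UNIV h" and m: "\<And>y z. dist (m y) (m z) = dist y z"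
  shows "locally_lipschitz_on UNIV (\<lambda>z. h (m z))"
  unfolding locally_lipschitz_on_def
proof
  fix s
  obtain u L where u: "u > 0" and L: "L-lipschitz_on (cball (m s) u) h"
    using h unfolding locally_lipschitz_on_def by (metis UNIV_I Int_UNIV_right)
  have "L-lipschitz_on (cball s u) (\<lambda>z. h (m z))"
  proof (rule lipschitz_onI)
    show "0 \<le> L" using L by (rule lipschitz_on_nonneg)
    fix y z assume "y \<in> cball s u" "z \<in> cball s u"
    then show "dist (h (m y)) (h (m z)) \<le> L * dist y z"
      using lipschitz_onD[OF L, of "m y" "m z"] by (simp add: m)
  qed
  with u show "\<exists>u>0. \<exists>L. L-lipschitz_on (cball s u \<inter> UNIV) (\<lambda>z. h (m z))" by auto
qed

theorem theorem4:
  fixes t0 tf :: real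
    and Pbar :: "(real^'np) set" and Wbar :: "(real^'nw) set"
    and x0 :: "real^'np \<Rightarrow> real^'nw \<Rightarrow> real^'nx"
    and f :: "real \<Rightarrow> real^'np \<Rightarrow> real^'nw \<Rightarrow> real^'nx \<Rightarrow> real^'nx"
    and x :: "real \<Rightarrow> real^'np \<Rightarrow> real^'nw \<Rightarrow> real^'nx"
    and g :: "real^'np \<Rightarrow> real^'nw \<Rightarrow> real^'nx \<Rightarrow> real"
    and G :: "real^'np \<Rightarrow> real^'nw \<Rightarrow> real"
    and x0cv x0cc :: "(real^'np) set \<Rightarrow> (real^'nw) set \<Rightarrow> real^'np \<Rightarrow> real^'nw \<Rightarrow> real^'nx"
    and fcv fcc :: "(real^'np) set \<Rightarrow> (real^'nw) set \<Rightarrow>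
          real \<Rightarrow> real^'np \<Rightarrow> real^'nw \<Rightarrow> real^'nx \<Rightarrow> real^'nx \<Rightarrow> real^'nx"
    and gcv gcc :: "(real^'np) set \<Rightarrow> (real^'nw) set \<Rightarrow>
          real^'np \<Rightarrow> real^'nw \<Rightarrow> real^'nx \<Rightarrow> real^'nx \<Rightarrow> real"
  assumes time: "t0 \<le> tf"
    and Pbar: "\<exists>a b. a \<le> b \<and> Pbar = {a..b}"
    and Wbar: "\<exists>a b. a \<le> b \<and> Wbar = {a..b}"
    and x0_lipschitz: "locally_lipschitz_on UNIV (\<lambda>(p, w). x0 p w)"
    and f_lipschitz: "locally_lipschitz_on UNIV (\<lambda>(t, p, w, y). f t p w y)"
    and x_solution: "\<And>p w. p \<in> Pbar \<Longrightarrow> w \<in> Wbar \<Longrightarrow> solves_ode t0 tf f x0 p w (\<lambda>t. x t p w)"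
    and x_unique: "\<And>p w y t. p \<in> Pbar \<Longrightarrow> w \<in> Wbar \<Longrightarrow> solves_ode t0 tf f x0 p w y \<Longrightarrow>
          t \<in> {t0..tf} \<Longrightarrow> y t = x t p w"
    and G: "\<And>p w. G p w = g p w (x tf p w)"
    and x0_relaxations: "\<And>P W. P \<in> interval_subsets Pbar \<Longrightarrow> W \<in> interval_subsets Wbar \<Longrightarrow>
          continuous_on (P \<times> W) (\<lambda>(p, w). x0cv P W p w) \<and>
          continuous_on (P \<times> W) (\<lambda>(p, w). x0cc P W p w) \<and>
          vec_relaxations_on (P \<times> W) (\<lambda>(p, w). x0 p w)
            (\<lambda>(p, w). x0cv P W p w) (\<lambda>(p, w). x0cc P W p w)"
    and f_relaxations_lipschitz:
      "\<And>P W. P \<in> interval_subsets Pbar \<Longrightarrow> W \<in> interval_subsets Wbar \<Longrightarrow>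
          lipschitz_continuous_on ({t0..tf} \<times> P \<times> W \<times> UNIV \<times> UNIV)
            (\<lambda>(t, p, w, y, z). fcv P W t p w y z) \<and>
          lipschitz_continuous_on ({t0..tf} \<times> P \<times> W \<times> UNIV \<times> UNIV)
            (\<lambda>(t, p, w, y, z). fcc P W t p w y z)"
    and f_relaxations:
      "\<And>P W \<phi> \<psi> t. P \<in> interval_subsets Pbar \<Longrightarrow> W \<in> interval_subsets Wbar \<Longrightarrow>
          continuous_on ({t0..tf} \<times> P \<times> W) (\<lambda>(t, p, w). \<phi> t p w) \<Longrightarrow>
          continuous_on ({t0..tf} \<times> P \<times> W) (\<lambda>(t, p, w). \<psi> t p w) \<Longrightarrow>
          t \<in> {t0..tf} \<Longrightarrow>
          vec_relaxations_on (P \<times> W) (\<lambda>(p, w). x t p w)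
            (\<lambda>(p, w). \<phi> t p w) (\<lambda>(p, w). \<psi> t p w) \<Longrightarrow>
          vec_relaxations_on (P \<times> W) (\<lambda>(p, w). f t p w (x t p w))
            (\<lambda>(p, w). fcv P W t p w (\<phi> t p w) (\<psi> t p w))
            (\<lambda>(p, w). fcc P W t p w (\<phi> t p w) (\<psi> t p w))"
    and g_relaxations_lipschitz:
      "\<And>P W. P \<in> interval_subsets Pbar \<Longrightarrow> W \<in> interval_subsets Wbar \<Longrightarrow>
          lipschitz_continuous_on (P \<times> W \<times> UNIV \<times> UNIV) (\<lambda>(p, w, y, z). gcv P W p w y z) \<and>
          lipschitz_continuous_on (P \<times> W \<times> UNIV \<times> UNIV) (\<lambda>(p, w, y, z). gcc P W p w y z)"
    and g_relaxations:
      "\<And>P W \<phi> \<psi>. P \<in> interval_subsets Pbar \<Longrightarrow> W \<in> interval_subsets Wbar \<Longrightarrow>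
          continuous_on (P \<times> W) (\<lambda>(p, w). \<phi> p w) \<Longrightarrow>
          continuous_on (P \<times> W) (\<lambda>(p, w). \<psi> p w) \<Longrightarrow>
          vec_relaxations_on (P \<times> W) (\<lambda>(p, w). x tf p w)
            (\<lambda>(p, w). \<phi> p w) (\<lambda>(p, w). \<psi> p w) \<Longrightarrow>
          relaxations_on (P \<times> W) (\<lambda>(p, w). g p w (x tf p w))
            (\<lambda>(p, w). gcv P W p w (\<phi> p w) (\<psi> p w))
            (\<lambda>(p, w). gcc P W p w (\<phi> p w) (\<psi> p w))"
    and P: "P \<in> interval_subsets Pbar" and W: "W \<in> interval_subsets Wbar"
  shows "\<exists>xcv xcc.
      solves_aux_system t0 tf P W (fcv P W) (fcc P W) (x0cv P W) (x0cc P W) xcv xcc \<and>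
      (\<forall>ycv ycc. solves_aux_system t0 tf P W (fcv P W) (fcc P W) (x0cv P W) (x0cc P W) ycv ycc \<longrightarrow>
         (\<forall>t\<in>{t0..tf}. \<forall>p\<in>P. \<forall>w\<in>W. ycv t p w = xcv t p w \<and> ycc t p w = xcc t p w)) \<and>
      state_relaxations t0 tf P W x xcv xcc \<and>
      relaxations_on (P \<times> W) (\<lambda>(p, w). G p w)
        (\<lambda>(p, w). gcv P W p w (xcv tf p w) (xcc tf p w))
        (\<lambda>(p, w). gcc P W p w (xcv tf p w) (xcc tf p w))"
proof -
  let ?I = "{t0..tf}" and ?Q = "P \<times> W"
  have P': "P \<subseteq> Pbar" "compact P" "convex P" and W': "W \<subseteq> Wbar" "compact W" "convex W"
    using P W by (auto simp: interval_subsets_def)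
  have Q: "compact ?Q" "convex ?Q"
    using P' W' by (auto intro: compact_Times convex_Times)
  \<comment> \<open>Both parameters become one \<open>q\<close> and the two coupled equations one
    equation for the pair, so that the results on a single parametric equation apply.\<close>
  define F where "F = (\<lambda>t q y. (fcv P W t (fst q) (snd q) (fst y) (snd y),
    fcc P W t (fst q) (snd q) (fst y) (snd y)))"
  define X where "X = (\<lambda>t q. x t (fst q) (snd q))"
  define f' where "f' = (\<lambda>t q y. f t (fst q) (snd q) y)"
  define c where "c = (\<lambda>q. (x0cv P W (fst q) (snd q), x0cc P W (fst q) (snd q)))"

  obtain L1 L2 where L1: "L1-lipschitz_on (?I \<times> P \<times> W \<times> UNIV \<times> UNIV) (\<lambda>(t, p, w, y, z). fcv P W t p w y z)"
    and L2: "L2-lipschitz_on (?I \<times> P \<times> W \<times> UNIV \<times> UNIV) (\<lambda>(t, p, w, y, z). fcc P W t p w y z)"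
    using f_relaxations_lipschitz[OF P W] unfolding lipschitz_continuous_on_def by blast
  \<comment> \<open>The norm of a pair is at most the sum of the norms, whence
    \<open>L1 + L2\<close>; the summand 1 makes the constant strictly positive, as
    \<open>picard_iteration\<close> requires.\<close>
  define L where "L = L1 + L2 + 1"
  have L: "L > 0" using lipschitz_on_nonneg[OF L1] lipschitz_on_nonneg[OF L2] by (simp add: L_def)
  have FL: "norm (F t q y - F t q z) \<le> L * norm (y - z)" if "t \<in> ?I" "q \<in> ?Q" for t q y z
  proof -
    obtain p w where q: "q = (p, w)" "p \<in> P" "w \<in> W" using \<open>q \<in> ?Q\<close> by (elim SigmaE)
    obtain y1 y2 z1 z2 where yz: "y = (y1, y2)" "z = (z1, z2)" by fastforce
    have d: "dist (t, p, w, y1, y2) (t, p, w, z1, z2) = norm (y - z)"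
      by (simp add: yz dist_Pair_Pair dist_norm norm_Pair)
    have "norm (F t q y - F t q z) \<le>
        dist (fcv P W t p w y1 y2) (fcv P W t p w z1 z2) + dist (fcc P W t p w y1 y2) (fcc P W t p w z1 z2)"
      by (simp add: F_def q yz dist_norm norm_Pair sqrt_sum_squares_le_sum)
    also have "\<dots> \<le> L1 * norm (y - z) + L2 * norm (y - z)"
      using lipschitz_onD[OF L1, of "(t, p, w, y1, y2)" "(t, p, w, z1, z2)"]
        lipschitz_onD[OF L2, of "(t, p, w, y1, y2)" "(t, p, w, z1, z2)"] q \<open>t \<in> ?I\<close>
      unfolding d by (intro add_mono) auto
    also have "\<dots> \<le> L * norm (y - z)" by (simp add: L_def algebra_simps)
    finally show ?thesis .
  qed
  have FC: "continuous_on (?I \<times> ?Q \<times> UNIV) (\<lambda>(t, q, y). F t q y)"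
  proof -
    let ?m = "\<lambda>(t :: real, q :: (real^'np) \<times> (real^'nw), y :: (real^'nx) \<times> (real^'nx)).
      (t, fst q, snd q, fst y, snd y)"
    have m: "continuous_on (?I \<times> ?Q \<times> UNIV) ?m"
      by (auto simp: split_def intro!: continuous_intros)
    have im: "?m ` (?I \<times> ?Q \<times> UNIV) \<subseteq> ?I \<times> P \<times> W \<times> UNIV \<times> UNIV"
      by auto
    show ?thesis
      using continuous_on_compose2[OF lipschitz_on_continuous_on[OF L1] m im]
        continuous_on_compose2[OF lipschitz_on_continuous_on[OF L2] m im]
      by (simp add: F_def split_def continuous_on_Pair)
  qed
  have cC: "continuous_on ?Q c"
    using x0_relaxations[OF P W] by (auto simp: c_def split_def intro: continuous_on_Pair)
  have F_rel: "vec_relaxations_on ?Q (\<lambda>q. f' t q (X t q)) (\<lambda>q. fst (F t q (u t q))) (\<lambda>q. snd (F t q (u t q)))"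
    if u: "continuous_on (?I \<times> ?Q) (\<lambda>(t, q). u t q)" and t: "t \<in> ?I"
      and rel: "vec_relaxations_on ?Q (X t) (\<lambda>q. fst (u t q)) (\<lambda>q. snd (u t q))" for u t
    using f_relaxations[OF P W, of "\<lambda>t p w. fst (u t (p, w))" "\<lambda>t p w. snd (u t (p, w))" t] u t rel
    by (simp add: F_def X_def f'_def split_def continuous_on_fst continuous_on_snd)

  have X_init: "X t0 q = x0 (fst q) (snd q)"
    and X_deriv: "\<And>t. t \<in> ?I \<Longrightarrow> ((\<lambda>s. X s q) has_vector_derivative f' t q (X t q)) (at t within ?I)"
    if "q \<in> ?Q" for q
  proof -
    have "solves_ode t0 tf f x0 (fst q) (snd q) (\<lambda>t. x t (fst q) (snd q))"
      using that P' W' by (intro x_solution) auto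
    then show "X t0 q = x0 (fst q) (snd q)"
      and "\<And>t. t \<in> ?I \<Longrightarrow> ((\<lambda>s. X s q) has_vector_derivative f' t q (X t q)) (at t within ?I)"
      by (simp_all add: solves_ode_def X_def f'_def)
  qed
  have X_int: "((\<lambda>s. f' s q (X s q)) has_integral X t q - x0 (fst q) (snd q)) {t0..t}"
    if "t \<in> ?I" "q \<in> ?Q" for t q
    unfolding X_init[OF that(2), symmetric]
  proof (rule fundamental_theorem_of_calculus)
    fix s assume "s \<in> {t0..t}"
    with that show "((\<lambda>s. X s q) has_vector_derivative f' s q (X s q)) (at s within {t0..t})"
      by (intro has_vector_derivative_within_subset[OF X_deriv[OF that(2)]]) auto
  qed (use that in auto)
  obtain B where B: "\<And>t q. t \<in> ?I \<Longrightarrow> q \<in> ?Q \<Longrightarrow> norm (X t q) \<le> B"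
  proof (rule solutions_bounded[where X = X and F = f' and ?x0.0 = "\<lambda>q. x0 (fst q) (snd q)"])
    let ?m = "\<lambda>(t :: real, q :: (real^'np) \<times> (real^'nw), y :: real^'nx). (t, fst q, snd q, y)"
    have "dist (?m y) (?m z) = dist y z" for y z
      by (simp add: split_def dist_prod_def add.assoc)
    from locally_lipschitz_on_isometry[OF f_lipschitz this]
    show "locally_lipschitz_on UNIV (\<lambda>(t, q, y). f' t q y)"
      by (simp add: f'_def split_def)
    show "continuous_on ?Q (\<lambda>q. x0 (fst q) (snd q))"
      using locally_lipschitz_on_UNIV_imp_continuous_on[OF x0_lipschitz] by (simp add: split_def)
  qed (use Q X_init X_deriv in auto)

  \<comment> \<open>The norm bound \<open>B\<close> bounds every component, so these constant
    vectors enclose \<open>X\<close>. They need not satisfy the initial conditions, which every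
    application of \<open>picard\<close> enforces.\<close>
  define u0 :: "real \<Rightarrow> (real^'np) \<times> (real^'nw) \<Rightarrow> (real^'nx) \<times> (real^'nx)"
    where "u0 = (\<lambda>t q. (\<chi> i. - B, \<chi> i. B))"
  have u0: "continuous_on (?I \<times> ?Q) (\<lambda>(t, q). u0 t q)"
    by (simp add: u0_def split_def)
  obtain u where u: "continuous_on (?I \<times> ?Q) (\<lambda>(t, q). u t q)"
    and fix_u: "\<And>t q. t \<in> ?I \<Longrightarrow> q \<in> ?Q \<Longrightarrow> picard t0 c F u t q = u t q"
    and lim_u: "\<And>t q. t \<in> ?I \<Longrightarrow> q \<in> ?Q \<Longrightarrow> (\<lambda>n. (picard t0 c F ^^ n) u0 t q) \<longlonglongrightarrow> u t q"
    using picard_iteration[OF FC FL L Q(1) cC u0] by metis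

  \<comment> \<open>Continuity is carried through the induction because \<open>F_rel\<close> needs
    it of the previous iterate. All times are treated together, since the next iterate at
    \<open>t\<close> integrates over all earlier ones.\<close>
  have iter: "continuous_on (?I \<times> ?Q) (\<lambda>(t, q). (picard t0 c F ^^ n) u0 t q) \<and>
    (\<forall>t\<in>?I. vec_relaxations_on ?Q (X t) (\<lambda>q. fst ((picard t0 c F ^^ n) u0 t q))
      (\<lambda>q. snd ((picard t0 c F ^^ n) u0 t q)))" for n
  proof (induction n)
    case 0
    have "- B \<le> X t q $ i" "X t q $ i \<le> B" if "t \<in> ?I" "q \<in> ?Q" for t q i
      using B[OF that] component_le_norm_cart[of "X t q" i] by auto
    then show ?case
      using u0 Q by (auto simp: u0_def vec_relaxations_on_def relaxations_on_def
          convex_on_const concave_on_const)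
  next
    case (Suc n)
    let ?v = "(picard t0 c F ^^ n) u0"
    have v: "continuous_on (?I \<times> ?Q) (\<lambda>(t, q). ?v t q)" using Suc by simp
    have "vec_relaxations_on ?Q (X t) (\<lambda>q. fst (picard t0 c F ?v t q)) (\<lambda>q. snd (picard t0 c F ?v t q))"
      if t: "t \<in> ?I" for t
    proof (rule vec_relaxations_on_picard[OF Q(2)])
      show "vec_relaxations_on ?Q (\<lambda>q. x0 (fst q) (snd q)) (\<lambda>q. fst (c q)) (\<lambda>q. snd (c q))"
        using x0_relaxations[OF P W] by (simp add: c_def split_def)
      show "vec_relaxations_on ?Q (\<lambda>q. f' s q (X s q))
          (\<lambda>q. fst (F s q (?v s q))) (\<lambda>q. snd (F s q (?v s q)))" if "s \<in> {t0..t}" for s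
        using Suc that t by (intro F_rel) auto
    qed (use X_int[OF t] picard_integrable[OF FC v t] in auto)
    with continuous_on_picard[OF FC cC v] show ?case by simp
  qed
  have rel_u: "vec_relaxations_on ?Q (X t) (\<lambda>q. fst (u t q)) (\<lambda>q. snd (u t q))" if t: "t \<in> ?I" for t
    unfolding vec_relaxations_on_def
  proof
    fix i
    show "relaxations_on ?Q (\<lambda>q. X t q $ i) (\<lambda>q. fst (u t q) $ i) (\<lambda>q. snd (u t q) $ i)"
    proof (rule relaxations_on_lim)
      show "relaxations_on ?Q (\<lambda>q. X t q $ i) (\<lambda>q. fst ((picard t0 c F ^^ n) u0 t q) $ i)
          (\<lambda>q. snd ((picard t0 c F ^^ n) u0 t q) $ i)" for n
        using iter[of n] t by (auto simp: vec_relaxations_on_def)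
    qed (auto intro!: tendsto_vec_nth tendsto_fst tendsto_snd lim_u[OF t])
  qed

  define xcv where "xcv = (\<lambda>t p w. fst (u t (p, w)))"
  define xcc where "xcc = (\<lambda>t p w. snd (u t (p, w)))"
  have u_init: "u t0 q = c q" if "q \<in> ?Q" for q
    using fix_u[of t0 q] time that by (simp add: picard_def)
  have u_deriv: "((\<lambda>s. u s q) has_vector_derivative F t q (u t q)) (at t within ?I)"
    if "t \<in> ?I" "q \<in> ?Q" for t q
  proof -
    have "((\<lambda>t. c q + integral {t0..t} (\<lambda>s. F s q (u s q))) has_vector_derivative 0 + F t q (u t q))
        (at t within ?I)"
      using continuous_on_slice[OF continuous_on_along[OF FC u] that(2)] that(1)
      by (intro has_vector_derivative_add has_vector_derivative_const integral_has_vector_derivative)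
    then have "((\<lambda>t. picard t0 c F u t q) has_vector_derivative F t q (u t q)) (at t within ?I)"
      by (simp add: picard_def)
    \<comment> \<open>\<open>fix_u\<close> identifies the two functions on the time interval only,
      which suffices for a derivative within it.\<close>
    then show ?thesis
      by (rule has_vector_derivative_transform[OF that(1), rotated]) (simp add: fix_u that)
  qed
  have sol: "solves_aux_system t0 tf P W (fcv P W) (fcc P W) (x0cv P W) (x0cc P W) xcv xcc"
    unfolding solves_aux_system_def
  proof (intro ballI conjI)
    fix p w assume pw: "p \<in> P" "w \<in> W"
    then have q: "(p, w) \<in> ?Q" by simp
    show "xcv t0 p w = x0cv P W p w" "xcc t0 p w = x0cc P W p w"
      using u_init[OF q] by (simp_all add: xcv_def xcc_def c_def)
    fix t assume t: "t \<in> ?I"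
    show "((\<lambda>s. xcv s p w) has_vector_derivative fcv P W t p w (xcv t p w) (xcc t p w)) (at t within ?I)"
      "((\<lambda>s. xcc s p w) has_vector_derivative fcc P W t p w (xcv t p w) (xcc t p w)) (at t within ?I)"
      using bounded_linear.has_vector_derivative[OF bounded_linear_fst u_deriv[OF t q]]
        bounded_linear.has_vector_derivative[OF bounded_linear_snd u_deriv[OF t q]]
      by (simp_all add: xcv_def xcc_def F_def)
  qed
  moreover have "ycv t p w = xcv t p w \<and> ycc t p w = xcc t p w"
    if y: "solves_aux_system t0 tf P W (fcv P W) (fcc P W) (x0cv P W) (x0cc P W) ycv ycc"
      and t: "t \<in> ?I" and pw: "p \<in> P" "w \<in> W" for ycv ycc t p w
  proof -
    have q: "(p, w) \<in> ?Q" using pw by simp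
    define v where "v = (\<lambda>s. (ycv s p w, ycc s p w))"
    have v: "(v has_vector_derivative F s (p, w) (v s)) (at s within ?I)" if "s \<in> ?I" for s
      using y pw that unfolding solves_aux_system_def v_def F_def
      by (auto intro!: has_vector_derivative_Pair)
    \<comment> \<open>Both curves obey the same equation at the same parameter, so the constant
      \<open>K\<close> is 0 and the bound is a multiple of the initial difference, which vanishes.
      The argument fixes \<open>(p, w)\<close> and thus covers competitors with arbitrary dependence
      on the parameters.\<close>
    have "norm (v t - u t (p, w)) \<le> (norm (v t0 - u t0 (p, w)) + 0 * (tf - t0)) * exp (L * (t - t0))"
      using FL[OF _ q] L
      by (intro norm_diff_bound_if_derivative_diff_bound[OF v u_deriv[OF _ q] _ _ _ t]) auto
    moreover have "v t0 = u t0 (p, w)"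
      using y pw unfolding solves_aux_system_def v_def u_init[OF q] by (simp add: c_def)
    ultimately have "v t = u t (p, w)" by simp
    then show ?thesis by (simp add: v_def xcv_def xcc_def prod_eq_iff)
  qed
  moreover have state: "state_relaxations t0 tf P W x xcv xcc"
    using rel_u by (simp add: state_relaxations_def X_def xcv_def xcc_def split_def)
  moreover have "relaxations_on ?Q (\<lambda>(p, w). G p w)
      (\<lambda>(p, w). gcv P W p w (xcv tf p w) (xcc tf p w))
      (\<lambda>(p, w). gcc P W p w (xcv tf p w) (xcc tf p w))"
  proof -
    have "continuous_on ?Q (\<lambda>q. u tf q)"
    proof -
      have "continuous_on ?Q (\<lambda>q. (tf, q))" "(\<lambda>q. (tf, q)) ` ?Q \<subseteq> ?I \<times> ?Q"
        using time by (auto intro: continuous_intros)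
      from continuous_on_compose2[OF u this] show ?thesis by simp
    qed
    then show ?thesis
      unfolding G using state time
      by (intro g_relaxations[OF P W])
        (auto simp: xcv_def xcc_def split_def state_relaxations_def
          intro: continuous_on_fst continuous_on_snd)
  qed
  ultimately show ?thesis by blast
qed

end
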